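(* Let $P$ be a training set in a metric space $(\mathcal{X},\mathsf{d})$, let $\alpha>0$, put $\beta=2/\alpha$, and let $R\subseteq P$ be an $\alpha$-consistent subset. Then $R$ is a weak $\varepsilon$-coreset for the nearest-neighbor rule on $P$ for queries in $\mathcal{Q}_\beta$ (for every $\varepsilon\ge 0$). Moreover, every query point $q\in\mathcal{Q}_\beta$ is correctly classified: the class of the nearest-neighbor of $q$ in $R$ equals the class of the exact nearest-neighbor of $q$ in $P$.
   Context: A training set is a finite set $P$ of distinct points of a metric space $(\mathcal{X},\mathsf{d})$, each $p\in P$ carrying a label (class) $l(p)$; at least two classes occur. For $q\in\mathcal{X}$ and nonempty $R\subseteq P$, $\mathsf{d}_{\mathrm{nn}}(q,R)=\min_{r\in R}\mathsf{d}(q,r)$. For $q\in\mathcal{X}$, let $\mathrm{nn}(q)$ be its nearest-neighbor in $P$ (ties broken arbitrarily but fixed; $\mathrm{nn}(p)=p$ for $p\in P$); the enemies of $q$ are the points of $P$ whose label differs from $l(\mathrm{nn}(q))$, and $\mathsf{d}_{\mathrm{ne}}(q,R)$ is the distance from $q$ to the closest enemy of $q$ lying in $R$ ($+\infty$ if there is none). For $\alpha\ge0$, a nonempty subset $R\subseteq P$ is $\alpha$-consistent if $\mathsf{d}_{\mathrm{nn}}(p,R)<\mathsf{d}_{\mathrm{ne}}(p,R)/(1+\alpha)$ for all $p\in P$. The chromatic density of $q\in\mathcal{X}$ with respect to $R$ is $\delta(q,R)=\mathsf{d}_{\mathrm{ne}}(q,R)/\mathsf{d}_{\mathrm{nn}}(q,R)-1$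 (equal to $+\infty$ if $\mathsf{d}_{\mathrm{nn}}(q,R)=0$). For $\beta\ge0$, $\mathcal{Q}_\beta=\{q\in\mathcal{X}\mid\delta(q,P)\ge\beta\}$. An $\varepsilon$-approximate nearest-neighbor of $q$ in $P$ is any $p\in P$ with $\mathsf{d}(q,p)\le(1+\varepsilon)\,\mathsf{d}_{\mathrm{nn}}(q,P)$. $R$ is a weak $\varepsilon$-coreset for the nearest-neighbor rule for queries in $\mathcal{Q}\subseteq\mathcal{X}$ if for every $q\in\mathcal{Q}$ the class of the exact nearest-neighbor of $q$ in $R$ equals the class of some $\varepsilon$-approximate nearest-neighbor of $q$ in $P$. *)

theory Defs
  imports "HOL-Analysis.Analysis"
begin

definition training_set :: "'a::metric_space set \<Rightarrow> ('a \<Rightarrow> 'c) \<Rightarrow> bool" where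
  "training_set P l \<longleftrightarrow> finite P \<and> (\<exists>p\<in>P. \<exists>p'\<in>P. l p \<noteq> l p')"

text \<open>Only used for finite nonempty \<open>R\<close>; otherwise the value of \<open>Min\<close> is unspecified.\<close>

definition nn_dist :: "'a::metric_space \<Rightarrow> 'a set \<Rightarrow> real" where
  "nn_dist q R = Min (dist q ` R)"

definition nearest_neighbors :: "'a::metric_space \<Rightarrow> 'a set \<Rightarrow> 'a set" where
  "nearest_neighbors q R = {r \<in> R. dist q r = nn_dist q R}"

definition approx_nearest_neighbors :: "real \<Rightarrow> 'a::metric_space \<Rightarrow> 'a set \<Rightarrow> 'a set" where
  "approx_nearest_neighbors \<epsilon> q P = {p \<in> P. dist q p \<le> (1 + \<epsilon>) * nn_dist q P}"

text \<open>A fixed but arbitrary way of breaking ties among the nearest neighbors in \<open>P\<close>. The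
  convention that \<open>nn p = p\<close> for \<open>p \<in> P\<close> need not be imposed: see \<open>nn_choice_self\<close>.\<close>

definition nn_choice :: "'a::metric_space set \<Rightarrow> ('a \<Rightarrow> 'a) \<Rightarrow> bool" where
  "nn_choice P nn \<longleftrightarrow> (\<forall>q. nn q \<in> nearest_neighbors q P)"

lemma nn_choice_self:
  assumes "finite P" "nn_choice P nn" "p \<in> P"
  shows "nn p = p"
proof -
  have "dist p (nn p) = Min (dist p ` P)"
    using assms(2) by (simp add: nn_choice_def nearest_neighbors_def nn_dist_def)
  also have "\<dots> \<le> dist p p"
    using assms(1,3) by (intro Min_le) auto
  finally show ?thesis by simp
qed

definition enemies :: "'a set \<Rightarrow> ('a \<Rightarrow> 'c) \<Rightarrow> ('a \<Rightarrow> 'a) \<Rightarrow> 'a \<Rightarrow> 'a set" where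
  "enemies P l nn q = {p \<in> P. l p \<noteq> l (nn q)}"

text \<open>The infimum over the empty set is \<open>\<infinity>\<close>.\<close>

definition ne_dist ::
  "'a::metric_space set \<Rightarrow> ('a \<Rightarrow> 'c) \<Rightarrow> ('a \<Rightarrow> 'a) \<Rightarrow> 'a \<Rightarrow> 'a set \<Rightarrow> ereal" where
  "ne_dist P l nn q R = (INF e \<in> enemies P l nn q \<inter> R. ereal (dist q e))"

definition alpha_consistent ::
  "'a::metric_space set \<Rightarrow> ('a \<Rightarrow> 'c) \<Rightarrow> ('a \<Rightarrow> 'a) \<Rightarrow> real \<Rightarrow> 'a set \<Rightarrow> bool" where
  "alpha_consistent P l nn \<alpha> R \<longleftrightarrow>
     R \<subseteq> P \<and> R \<noteq> {} \<and>
     (\<forall>p\<in>P. ereal (nn_dist p R) < ne_dist P l nn p R / ereal (1 + \<alpha>))"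

definition chromatic_density ::
  "'a::metric_space set \<Rightarrow> ('a \<Rightarrow> 'c) \<Rightarrow> ('a \<Rightarrow> 'a) \<Rightarrow> 'a \<Rightarrow> 'a set \<Rightarrow> ereal" where
  "chromatic_density P l nn q R =
     (if nn_dist q R = 0 then \<infinity> else ne_dist P l nn q R / ereal (nn_dist q R) - 1)"

definition query_set ::
  "'a::metric_space set \<Rightarrow> ('a \<Rightarrow> 'c) \<Rightarrow> ('a \<Rightarrow> 'a) \<Rightarrow> real \<Rightarrow> 'a set" where
  "query_set P l nn \<beta> = {q. chromatic_density P l nn q P \<ge> ereal \<beta>}"

text \<open>Ranging over all nearest neighbors \<open>r\<close> of \<open>q\<close> in \<open>R\<close> makes the notion independent of how
  ties in \<open>R\<close> are broken.\<close>

definition weak_coreset ::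
  "'a::metric_space set \<Rightarrow> ('a \<Rightarrow> 'c) \<Rightarrow> real \<Rightarrow> 'a set \<Rightarrow> 'a set \<Rightarrow> bool" where
  "weak_coreset P l \<epsilon> Q R \<longleftrightarrow>
     R \<subseteq> P \<and> R \<noteq> {} \<and>
     (\<forall>q\<in>Q. \<forall>r\<in>nearest_neighbors q R. \<exists>p\<in>approx_nearest_neighbors \<epsilon> q P. l r = l p)"

end

theory Submission
  imports Defs
begin

text \<open>Let \<open>p = nn q\<close> and \<open>D = dist q p\<close>, and suppose the nearest neighbor \<open>r\<close> of \<open>q\<close> in \<open>R\<close> were
  an enemy of \<open>q\<close>, hence of \<open>p\<close>. With \<open>a = nn_dist p R\<close>, nearness of \<open>r\<close> gives
  \<open>dist q r \<le> D + a\<close>, and consistency at \<open>p\<close> gives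
  \<open>(1 + \<alpha>) * a < dist p r \<le> 2 * D + a\<close>, i.e. \<open>\<alpha> * a < 2 * D\<close>. So \<open>D > 0\<close> and
  \<open>dist q r < (1 + 2 / \<alpha>) * D\<close>, contradicting the chromatic density of \<open>q\<close>.\<close>

lemma nn_dist_le:
  assumes "finite R" "r \<in> R"
  shows "nn_dist q R \<le> dist q r"
  using assms unfolding nn_dist_def by (intro Min_le) auto

lemma nn_dist_attained:
  assumes "finite R" "R \<noteq> {}"
  obtains x where "x \<in> R" "dist q x = nn_dist q R"
proof -
  have "Min (dist q ` R) \<in> dist q ` R"
    using assms by (intro Min_in) auto
  then show ?thesis
    using that unfolding nn_dist_def by fastforce
qed

lemma ne_dist_le:
  assumes "e \<in> P" "e \<in> R" "l e \<noteq> l (nn q)"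
  shows "ne_dist P l nn q R \<le> ereal (dist q e)"
  using assms unfolding ne_dist_def enemies_def by (intro INF_lower) auto

text \<open>Since \<open>nn p = p\<close> on \<open>P\<close>, a label differing from
  \<open>l p\<close> makes \<open>r\<close> an enemy of \<open>p\<close>, so \<open>dist p r\<close>
  is one of the distances whose infimum is \<open>ne_dist P l nn p R\<close>.\<close>

lemma alpha_consistent_enemy_dist:
  assumes "finite P" "nn_choice P nn" "\<alpha> > 0" "alpha_consistent P l nn \<alpha> R"
    and "p \<in> P" "r \<in> R" "l r \<noteq> l p"
  shows "(1 + \<alpha>) * nn_dist p R < dist p r"
proof -
  have "r \<in> P" and *: "ereal (nn_dist p R) < ne_dist P l nn p R / ereal (1 + \<alpha>)"
    using assms(4-6) unfolding alpha_consistent_def by auto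
  have "ne_dist P l nn p R \<le> ereal (dist p r)"
    using assms(6,7) nn_choice_self[OF assms(1,2,5)] \<open>r \<in> P\<close> by (intro ne_dist_le) auto
  then have "ne_dist P l nn p R / ereal (1 + \<alpha>) \<le> ereal (dist p r) / ereal (1 + \<alpha>)"
    using assms(3) by (intro ereal_divide_right_mono) auto
  with * have "ereal (nn_dist p R) < ereal (dist p r / (1 + \<alpha>))"
    using assms(3) by (auto dest: less_le_trans)
  then show ?thesis
    using assms(3) by (simp add: field_simps)
qed

text \<open>Positivity of \<open>nn_dist q P\<close> selects the quotient branch of
  \<open>chromatic_density\<close>, where the bound \<beta> can be multiplied out.\<close>

lemma query_set_enemy_dist:
  assumes "q \<in> query_set P l nn \<beta>" "nn_dist q P > 0" "e \<in> P" "l e \<noteq> l (nn q)"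
  shows "(1 + \<beta>) * nn_dist q P \<le> dist q e"
proof -
  have "ereal \<beta> \<le> ne_dist P l nn q P / ereal (nn_dist q P) - 1"
    using assms(1,2) by (auto simp: query_set_def chromatic_density_def)
  also have "\<dots> \<le> ereal (dist q e) / ereal (nn_dist q P) - 1"
    using assms(2-4) by (intro ereal_minus_mono ereal_divide_right_mono ne_dist_le) auto
  also have "\<dots> = ereal (dist q e / nn_dist q P - 1)"
    using assms(2) by (simp add: one_ereal_def)
  finally show ?thesis
    using assms(2) by (simp add: field_simps)
qed

lemma query_set_correctly_classified:
  assumes "finite P" "nn_choice P nn" "\<alpha> > 0" "alpha_consistent P l nn \<alpha> R"
    and "q \<in> query_set P l nn (2 / \<alpha>)" "r \<in> nearest_neighbors q R"
  shows "l r = l (nn q)"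
proof (rule ccontr)
  assume neq: "l r \<noteq> l (nn q)"
  define D where "D = nn_dist q P"
  define a where "a = nn_dist (nn q) R"
  have nnP: "nn q \<in> P" and D: "dist q (nn q) = D"
    using assms(2) by (auto simp: nn_choice_def nearest_neighbors_def D_def)
  have R: "R \<subseteq> P" "R \<noteq> {}"
    using assms(4) by (auto simp: alpha_consistent_def)
  then have fin: "finite R"
    using assms(1) finite_subset by blast
  have r: "r \<in> R" "dist q r = nn_dist q R"
    using assms(6) by (auto simp: nearest_neighbors_def)
  obtain x where x: "x \<in> R" "dist (nn q) x = a"
    using nn_dist_attained[OF fin R(2)] unfolding a_def by metis
  \<comment> \<open>The competitor to \<open>r\<close> is \<open>x\<close>, a point of
    \<open>R\<close> nearest to \<open>nn q\<close>, reached from \<open>q\<close> through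
    \<open>nn q\<close>.\<close>
  have near: "dist q r \<le> D + a"
    using nn_dist_le[OF fin x(1), of q] r(2) dist_triangle[of q x "nn q"] D x(2) by linarith
  have "(1 + \<alpha>) * a < dist (nn q) r"
    using alpha_consistent_enemy_dist[OF assms(1-4) nnP r(1) neq] by (simp add: a_def)
  also have "\<dots> \<le> D + dist q r"
    using dist_triangle[of "nn q" r q] D by (simp add: dist_commute)
  finally have cons: "\<alpha> * a < 2 * D"
    using near by (simp add: algebra_simps)
  moreover have "a \<ge> 0"
    using x(2) zero_le_dist by metis
  \<comment> \<open>This rules out the case where the density of \<open>q\<close> is infinite by
    convention.\<close>
  ultimately have "D > 0"
    using assms(3) by (smt (verit) mult_nonneg_nonneg)
  then have "(1 + 2 / \<alpha>) * D \<le> dist q r"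
    using query_set_enemy_dist[OF assms(5)] r(1) R(1) neq by (auto simp: D_def)
  \<comment> \<open>The choice 2/\<alpha> makes both bounds on \<open>dist q r\<close> meet at the
    same multiple of \<open>D\<close>; the strict inequality in consistency decides.\<close>
  moreover have "a < 2 / \<alpha> * D"
    using cons assms(3) by (simp add: field_simps)
  ultimately show False
    using near by (simp add: algebra_simps)
qed

text \<open>Makes \<open>nn q\<close> the coreset witness for all \<epsilon> at once: correct
  classification then yields the weak coreset property.\<close>

lemma nn_in_approx_nearest_neighbors:
  assumes "nn_choice P nn" "\<epsilon> \<ge> 0"
  shows "nn q \<in> approx_nearest_neighbors \<epsilon> q P"
proof -
  have "nn q \<in> P" "dist q (nn q) = nn_dist q P"
    using assms(1) by (auto simp: nn_choice_def nearest_neighbors_def)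
  moreover from this have "nn_dist q P \<ge> 0"
    using zero_le_dist by metis
  ultimately show ?thesis
    using assms(2) by (simp add: approx_nearest_neighbors_def algebra_simps)
qed

theorem theorem6:
  fixes P R :: "'a::metric_space set"
    and l :: "'a \<Rightarrow> 'c"
    and nn :: "'a \<Rightarrow> 'a"
    and \<alpha> \<beta> :: real
  assumes "training_set P l"
    and "nn_choice P nn"
    and "\<alpha> > 0"
    and "\<beta> = 2 / \<alpha>"
    and "alpha_consistent P l nn \<alpha> R"
  shows "(\<forall>\<epsilon>\<ge>0. weak_coreset P l \<epsilon> (query_set P l nn \<beta>) R) \<and>
         (\<forall>q\<in>query_set P l nn \<beta>. \<forall>r\<in>nearest_neighbors q R. l r = l (nn q))"
proof -
  have "finite P"
    using assms(1) by (simp add: training_set_def)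
  then have correct: "\<forall>q\<in>query_set P l nn \<beta>. \<forall>r\<in>nearest_neighbors q R. l r = l (nn q)"
    using query_set_correctly_classified[OF _ assms(2,3,5)] assms(4) by blast
  moreover have "R \<subseteq> P" "R \<noteq> {}"
    using assms(5) by (auto simp: alpha_consistent_def)
  ultimately show ?thesis
    using nn_in_approx_nearest_neighbors[OF assms(2)] unfolding weak_coreset_def by blast
qed

end
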